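(* In the needle in a haystack problem on $\{0,\dots,n-1\}$, for any sought number $s\in\{0,\dots,n-1\}$, the shift strategy satisfies $$\Pr[\mathcal V]\ \ge\ \frac{(1+o(1))\,\log n}{n\,\log\log n},$$ where $\mathcal V$ is the event that the sought number $s$ is found, i.e. that $\sigma(s+h \bmod n)=s$ for the hint $h$ of the shift strategy, and $o(1)$ is as $n\to\infty$.
   Context: $\log=\log_2$. Needle in a haystack problem: a permutation $\sigma$ of $\{0,\dots,n-1\}$ is chosen uniformly at random. A strategy is a pair of (possibly randomized) functions: a hint $h=h(\sigma)\in\{0,\dots,n-1\}$, chosen with knowledge of $\sigma$ but not of the sought number $s$, and an index $i=i(h,s)\in\{0,\dots,n-1\}$, chosen with knowledge only of $h$ and $s$. The sought number is found (event $\mathcal V$) if $\sigma(i)=s$. The probability is over the random choice of $\sigma$ and any randomness in the strategy; no assumption is made about $s$. Shift strategy: let $h\in\{0,\dots,n-1\}$ maximize $\big|\{\ell\in\{0,\dots,n-1\}: \ell=\sigma(\ell+h \bmod n)\}\big|$. In order to find the number $s$ in $\sigma$, check $\sigma(s+h \bmod n)$, i.e. take the index $i(h,s)=s+h \bmod n$.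
   Formalization: When several h maximize, the hint is assumed to be selected (possibly at random) by a rule depending on σ only through the set of maximizers; with an arbitrary σ-dependent choice among tied maximizers the bound for a fixed s can fail. *)

theory Defs
  imports "HOL-Probability.Probability" "HOL-Combinatorics.Permutations"
begin

text \<open>
  A strategy consists of a randomized hint function \<open>H\<close>, which sees the permutation but not the
  sought number, and a randomized index function \<open>I\<close>, which sees only the hint and the sought
  number. Outcomes record the permutation, the hint and the inspected index.
\<close>

definition needle_game ::
    "nat \<Rightarrow> ((nat \<Rightarrow> nat) \<Rightarrow> nat pmf) \<Rightarrow> (nat \<Rightarrow> nat \<Rightarrow> nat pmf) \<Rightarrow> nat
      \<Rightarrow> ((nat \<Rightarrow> nat) \<times> nat \<times> nat) pmf" where
  "needle_game n H I s = do {
     \<sigma> \<leftarrow> pmf_of_set {\<sigma>. \<sigma> permutes {0..<n}};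
     h \<leftarrow> H \<sigma>;
     i \<leftarrow> I h s;
     return_pmf (\<sigma>, h, i)
   }"

definition found_prob ::
    "nat \<Rightarrow> ((nat \<Rightarrow> nat) \<Rightarrow> nat pmf) \<Rightarrow> (nat \<Rightarrow> nat \<Rightarrow> nat pmf) \<Rightarrow> nat \<Rightarrow> real" where
  "found_prob n H I s = measure_pmf.prob (needle_game n H I s) {(\<sigma>, h, i). \<sigma> i = s}"

definition shift_matches :: "nat \<Rightarrow> (nat \<Rightarrow> nat) \<Rightarrow> nat \<Rightarrow> nat set" where
  "shift_matches n \<sigma> h = {l \<in> {0..<n}. l = \<sigma> ((l + h) mod n)}"

definition best_shifts :: "nat \<Rightarrow> (nat \<Rightarrow> nat) \<Rightarrow> nat set" where
  "best_shifts n \<sigma> = {h. is_arg_max (\<lambda>h. card (shift_matches n \<sigma> h)) (\<lambda>h. h \<in> {0..<n}) h}"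

text \<open>
  The maximizing shift need not be unique, so the hint requires a rule for breaking ties. A rule
  is any (possibly randomized) way of picking an element from the set of maximizers, such as the
  least one or a uniformly random one. The choice depends on the permutation only through that
  set: if it could inspect the permutation further, ties could be broken against a particular
  sought number, because the match sets of distinct shifts are disjoint.
\<close>

definition tie_breaking :: "(nat set \<Rightarrow> nat pmf) \<Rightarrow> bool" where
  "tie_breaking T \<longleftrightarrow> (\<forall>A. A \<noteq> {} \<longrightarrow> set_pmf (T A) \<subseteq> A)"

definition shift_hint :: "nat \<Rightarrow> (nat set \<Rightarrow> nat pmf) \<Rightarrow> (nat \<Rightarrow> nat) \<Rightarrow> nat pmf" where
  "shift_hint n T \<sigma> = T (best_shifts n \<sigma>)"

definition shift_index :: "nat \<Rightarrow> nat \<Rightarrow> nat \<Rightarrow> nat pmf" where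
  "shift_index n h s = return_pmf ((s + h) mod n)"

end

theory Submission
  imports Defs "HOL-Real_Asymp.Real_Asymp"
begin

text \<open>
  Conjugating \<open>\<sigma>\<close> by a rotation preserves the number of matches of every shift, so the success
  probability does not depend on \<open>s\<close> and equals \<open>1 / n\<close> times the expected size of a largest match
  set. Let \<open>Z\<close> count the pairs of a shift and a \<open>k\<close>-subset of its match set. Then
  \<open>E Z = n / k!\<close> and \<open>E Z\<^sup>2 \<le> (n / k!)\<^sup>2 + 2\<^sup>k n / k!\<close>, hence by Cauchy-Schwarz some shift has at
  least \<open>k\<close> matches with probability at least \<open>1 / (1 + 2\<^sup>k k! / n)\<close>. This tends to \<open>1\<close> for a
  suitable \<open>k \<sim> ln n / ln (ln n)\<close>.
\<close>

section \<open>Permutations with prescribed values\<close>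

text \<open>Left composition with \<open>\<pi>\<close> maps the permutations of \<open>U - A\<close>
  bijectively onto the permutations in question.\<close>

lemma card_permutes_agreeing:
  assumes "finite U" "\<pi> permutes U" "A \<subseteq> U"
  shows "card {\<tau>. \<tau> permutes U \<and> (\<forall>a\<in>A. \<tau> a = \<pi> a)} = fact (card U - card A)"
proof -
  have "{\<tau>. \<tau> permutes U \<and> (\<forall>a\<in>A. \<tau> a = \<pi> a)} = (\<lambda>\<rho>. \<pi> \<circ> \<rho>) ` {\<rho>. \<rho> permutes (U - A)}"
    (is "?L = ?R")
  proof
    show "?R \<subseteq> ?L"
    proof
      fix \<tau> assume "\<tau> \<in> ?R"
      then obtain \<rho> where \<rho>: "\<rho> permutes (U - A)" "\<tau> = \<pi> \<circ> \<rho>" by auto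
      have "\<rho> permutes U" using \<rho>(1) by (rule permutes_subset) auto
      then show "\<tau> \<in> ?L" using assms \<rho> permutes_not_in[OF \<rho>(1)]
        by (auto intro: permutes_compose)
    qed
    show "?L \<subseteq> ?R"
    proof
      fix \<tau> assume \<tau>: "\<tau> \<in> ?L"
      define \<rho> where "\<rho> = inv \<pi> \<circ> \<tau>"
      have "\<rho> permutes U" unfolding \<rho>_def
        using \<tau> assms by (auto intro: permutes_compose permutes_inv)
      moreover have "\<rho> a = a" if "a \<in> A" for a
        using \<tau> that permutes_inverses(2)[OF assms(2)] by (auto simp: \<rho>_def)
      ultimately have "\<rho> permutes (U - A)"
        by (auto intro: permutes_superset)
      moreover have "\<tau> = \<pi> \<circ> \<rho>"
        using permutes_inverses(1)[OF assms(2)] by (auto simp: \<rho>_def)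
      ultimately show "\<tau> \<in> ?R" by auto
    qed
  qed
  moreover have "inj_on (\<lambda>\<rho>. \<pi> \<circ> \<rho>) {\<rho>. \<rho> permutes (U - A)}"
    by (rule inj_onI) (metis assms(2) comp_assoc permutes_inv_o(2) id_comp)
  ultimately have "card {\<tau>. \<tau> permutes U \<and> (\<forall>a\<in>A. \<tau> a = \<pi> a)} = card {\<rho>. \<rho> permutes (U - A)}"
    by (simp add: card_image)
  also have "\<dots> = fact (card U - card A)"
    using assms by (intro card_permutations) (auto simp: card_Diff_subset finite_subset)
  finally show ?thesis .
qed

text \<open>The values \<open>f\<close> on \<open>A\<close> need not extend to a permutation. If
  they do not, nothing is counted; otherwise any extension serves as the \<open>\<pi>\<close> of the
  exact count.\<close>

lemma card_permutes_agreeing_le: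
  assumes "finite U" "A \<subseteq> U"
  shows "card {\<tau>. \<tau> permutes U \<and> (\<forall>a\<in>A. \<tau> a = f a)} \<le> fact (card U - card A)"
proof (cases "{\<tau>. \<tau> permutes U \<and> (\<forall>a\<in>A. \<tau> a = f a)} = {}")
  case False
  then obtain \<pi> where \<pi>: "\<pi> permutes U" "\<forall>a\<in>A. \<pi> a = f a" by auto
  then have "{\<tau>. \<tau> permutes U \<and> (\<forall>a\<in>A. \<tau> a = f a)}
      = {\<tau>. \<tau> permutes U \<and> (\<forall>a\<in>A. \<tau> a = \<pi> a)}" by auto
  then show ?thesis using card_permutes_agreeing[OF assms(1) \<pi>(1) assms(2)] by simp
qed (simp only: card.empty)

section \<open>Factorial sums over pairs of \<open>k\<close>-sets\<close>

lemma choose_mult_fact_le: "(m choose j) * fact (m - j) \<le> (fact m :: nat)"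
proof (cases "j \<le> m")
  case True
  have "(m choose j) * fact (m - j) * 1 \<le> (m choose j) * fact (m - j) * fact j"
    by (intro mult_left_mono fact_ge_1) auto
  also have "\<dots> = fact m"
    using binomial_fact_lemma[OF True] by (simp only: mult_ac)
  finally show ?thesis by simp
qed (simp add: binomial_eq_0)

text \<open>Controls pairs of \<open>k\<close>-sets belonging to the same shift. A set
  \<open>S'\<close> is split into \<open>T = S \<inter> S'\<close> and \<open>R = S' - S\<close>;
  each of the \<open>2 ^ k\<close> choices of \<open>T\<close> contributes at most
  \<open>fact (card U - k)\<close>.\<close>

lemma sum_fact_Un_le:
  assumes "finite U" "S \<subseteq> U" "card S = k"
  shows "(\<Sum>S'\<in>{S'. S' \<subseteq> U \<and> card S' = k}. fact (card U - card (S \<union> S')))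
           \<le> (2 ^ k * fact (card U - k) :: nat)"
proof -
  let ?K = "{S'. S' \<subseteq> U \<and> card S' = k}"
  let ?R = "\<lambda>T. {R. R \<subseteq> U - S \<and> card R = k - card T}"
  let ?g = "\<lambda>(T, R). fact (card U - k - card R) :: nat"
  have finS: "finite S" using assms finite_subset by auto
  have fin: "finite (Sigma (Pow S) ?R)"
    using finS assms by (intro finite_SigmaI) auto
  have inj: "inj_on (\<lambda>S'. (S \<inter> S', S' - S)) ?K"
    by (rule inj_onI) blast
  have fst: "card (S' - S) = k - card (S \<inter> S')" if "S' \<in> ?K" for S'
  proof -
    have "finite S'" using that assms finite_subset by auto
    then show ?thesis using that by (simp add: card_Diff_subset_Int Int_commute)
  qed
  have un: "card (S \<union> S') = k + card (S' - S)" if "S' \<in> ?K" for S'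
  proof -
    have "finite S'" using that assms finite_subset by auto
    then have "card (S \<union> (S' - S)) = card S + card (S' - S)"
      using finS by (intro card_Un_disjoint) auto
    then show ?thesis using assms by simp
  qed
  have "(\<Sum>S'\<in>?K. fact (card U - card (S \<union> S')))
      = (\<Sum>S'\<in>?K. ?g (S \<inter> S', S' - S))"
    using un by (intro sum.cong) auto
  also have "\<dots> = sum ?g ((\<lambda>S'. (S \<inter> S', S' - S)) ` ?K)"
    by (simp add: sum.reindex[OF inj] o_def)
  also have "\<dots> \<le> sum ?g (Sigma (Pow S) ?R)"
    using fin fst by (intro sum_mono2) auto
  also have "\<dots> = (\<Sum>T\<in>Pow S. \<Sum>R\<in>?R T. fact (card U - k - card R))"
    using finS assms by (subst sum.Sigma) auto
  also have "\<dots> = (\<Sum>T\<in>Pow S. (card U - k choose (k - card T)) * fact (card U - k - (k - card T)))"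
  proof (rule sum.cong[OF refl])
    fix T assume "T \<in> Pow S"
    have "card (?R T) = (card U - k choose (k - card T))"
      using assms finS by (subst n_subsets) (auto simp: card_Diff_subset)
    then show "(\<Sum>R\<in>?R T. fact (card U - k - card R)) =
       (card U - k choose (k - card T)) * fact (card U - k - (k - card T))" by simp
  qed
  \<comment> \<open>The estimate is lossy here: a nonzero summand equals
    \<open>fact (card U - k)\<close> divided by \<open>fact (k - card T)\<close>, and this divisor
    is dropped.\<close>
  also have "\<dots> \<le> (\<Sum>T\<in>Pow S. fact (card U - k))"
    by (intro sum_mono choose_mult_fact_le)
  also have "\<dots> = 2 ^ k * fact (card U - k)"
    using assms finS by (simp add: card_Pow)
  finally show ?thesis .
qed

text \<open>Controls pairs of \<open>k\<close>-sets belonging to distinct shifts, which must be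
  disjoint. Every union has \<open>2 * k\<close> elements, so the sum is a binomial coefficient
  times a factorial; without the factor \<open>2 ^ k\<close>, it keeps the second moment close to
  the square of the first.\<close>

lemma sum_fact_disjoint_le:
  assumes "finite U" "S \<subseteq> U" "card S = k"
  shows "(\<Sum>S'\<in>{S'. S' \<subseteq> U - S \<and> card S' = k}. fact (card U - card (S \<union> S'))) * fact k
           \<le> (fact (card U - k) :: nat)"
proof -
  have finS: "finite S" using assms finite_subset by auto
  have un: "card (S \<union> S') = k + k" if "S' \<subseteq> U - S" "card S' = k" for S'
  proof -
    have "finite S'" using that assms finite_subset by blast
    then have "card (S \<union> S') = card S + card S'"
      using finS that by (intro card_Un_disjoint) auto
    then show ?thesis using assms that by simp
  qed
  have "(\<Sum>S'\<in>{S'. S' \<subseteq> U - S \<and> card S' = k}. fact (card U - card (S \<union> S')))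
     = (\<Sum>S'\<in>{S'. S' \<subseteq> U - S \<and> card S' = k}. fact (card U - k - k) :: nat)"
    using un by (intro sum.cong) auto
  also have "\<dots> = (card U - k choose k) * fact (card U - k - k)"
    using assms finS by (simp add: n_subsets card_Diff_subset)
  finally have "(\<Sum>S'\<in>{S'. S' \<subseteq> U - S \<and> card S' = k}. fact (card U - card (S \<union> S'))) * fact k
     = (card U - k choose k) * fact (card U - k - k) * (fact k :: nat)" by simp
  also have "\<dots> \<le> fact (card U - k)"
  proof (cases "k \<le> card U - k")
    case True
    then show ?thesis using binomial_fact_lemma[OF True] by (simp add: mult_ac)
  qed (simp add: binomial_eq_0)
  finally show ?thesis .
qed

section \<open>The second moment method\<close>

text \<open>Cauchy-Schwarz applied to \<open>Z\<close> and the indicator of its support. Dividing by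
  the second moment gives a lower bound on how often \<open>Z\<close> is nonzero.\<close>

lemma Cauchy_Schwarz_support:
  fixes Z :: "'a \<Rightarrow> real"
  assumes "finite P"
  shows "(\<Sum>x\<in>P. Z x)\<^sup>2 \<le> card {x\<in>P. Z x \<noteq> 0} * (\<Sum>x\<in>P. (Z x)\<^sup>2)"
proof -
  let ?N = "{x\<in>P. Z x \<noteq> 0}"
  have "(\<Sum>x\<in>P. Z x) = (\<Sum>x\<in>?N. 1 * Z x)"
    using assms by (intro sum.mono_neutral_cong_right) auto
  also have "\<dots>\<^sup>2 \<le> (\<Sum>x\<in>?N. 1\<^sup>2) * (\<Sum>x\<in>?N. (Z x)\<^sup>2)"
    by (rule Cauchy_Schwarz_ineq_sum)
  also have "(\<Sum>x\<in>?N. (Z x)\<^sup>2) = (\<Sum>x\<in>P. (Z x)\<^sup>2)"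
    using assms by (intro sum.mono_neutral_cong_left) auto
  finally show ?thesis by simp
qed

text \<open>
  The shifts enter only as a family of permutations no two of which agree anywhere; this is why
  pairs of \<open>k\<close>-subsets belonging to distinct shifts contribute to \<open>E Z\<^sup>2\<close> only when disjoint.
\<close>

lemma card_permutes_many_agreements_ge:
  fixes \<rho> :: "'i \<Rightarrow> 'a \<Rightarrow> 'a"
  assumes U: "finite U" and I: "finite I" "I \<noteq> {}"
    and perm: "\<And>i. i \<in> I \<Longrightarrow> \<rho> i permutes U"
    and dis: "\<And>i j x. i \<in> I \<Longrightarrow> j \<in> I \<Longrightarrow> i \<noteq> j \<Longrightarrow> x \<in> U \<Longrightarrow> \<rho> i x \<noteq> \<rho> j x"
    and k: "k \<le> card U"
  shows "fact (card U) \<le>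
     card {\<tau>. \<tau> permutes U \<and> (\<exists>i\<in>I. k \<le> card {x\<in>U. \<tau> x = \<rho> i x})}
       * (1 + 2 ^ k * fact k / real (card I))"
proof -
  let ?n = "card U" and ?m = "card I"
  let ?P = "{\<tau>. \<tau> permutes U}"
  let ?K = "{S. S \<subseteq> U \<and> card S = k}"
  let ?J = "I \<times> ?K"
  define agr where "agr \<tau> p \<longleftrightarrow> (\<forall>x\<in>snd p. \<tau> x = \<rho> (fst p) x)" for \<tau> and p :: "'i \<times> 'a set"
  define Z where "Z \<tau> = card {p\<in>?J. agr \<tau> p}" for \<tau>
  have finP: "finite ?P" using U by (rule finite_permutations)
  have finK: "finite ?K" using U by simp
  have finJ: "finite ?J" using I finK by simp
  have cK: "card ?K = (?n choose k)" using U by (rule n_subsets)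
  have Zsum: "Z \<tau> = (\<Sum>p\<in>?J. of_bool (agr \<tau> p))" for \<tau>
    using finJ by (simp add: Z_def sum.If_cases of_bool_def Int_def)
  have card_sum: "card {\<tau>\<in>?P. Q \<tau>} = (\<Sum>\<tau>\<in>?P. of_bool (Q \<tau>))" for Q
    using finP by (simp add: sum.If_cases of_bool_def Int_def)
  \<comment> \<open>The first moment, with the denominator \<open>fact k\<close> cleared so that the
    computation stays in the natural numbers.\<close>
  have first: "(\<Sum>\<tau>\<in>?P. Z \<tau>) * fact k = ?m * fact ?n"
  proof -
    have "(\<Sum>\<tau>\<in>?P. Z \<tau>) = (\<Sum>p\<in>?J. card {\<tau>\<in>?P. agr \<tau> p})"
      unfolding Zsum card_sum by (rule sum.swap)
    also have "\<dots> = (\<Sum>p\<in>?J. fact (?n - k))"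
      using U perm by (intro sum.cong) (auto simp: agr_def card_permutes_agreeing)
    also have "\<dots> = ?m * ((?n choose k) * fact (?n - k))"
      using cK by (simp add: card_cartesian_product)
    finally show ?thesis using binomial_fact_lemma[OF k] by (simp add: mult_ac)
  qed
  \<comment> \<open>With \<open>(i, S)\<close> fixed, the joint counts are summed over the
    \<open>k\<close>-sets of a single shift \<open>j\<close>. Only \<open>j = i\<close> incurs the
    factor \<open>2 ^ k * fact k\<close>; there is one such \<open>j\<close>.\<close>
  have pair: "(\<Sum>S'\<in>?K. card {\<tau>\<in>?P. agr \<tau> (i, S) \<and> agr \<tau> (j, S')}) * fact k
       \<le> fact (?n - k) * (if i = j then 2 ^ k * fact k else 1)"
    if i: "i \<in> I" and j: "j \<in> I" and S: "S \<in> ?K" for i j S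
  proof (cases "i = j")
    case True
    have "(\<Sum>S'\<in>?K. card {\<tau>\<in>?P. agr \<tau> (i, S) \<and> agr \<tau> (j, S')})
        \<le> (\<Sum>S'\<in>?K. fact (?n - card (S \<union> S')))"
    proof (rule sum_mono)
      fix S' assume "S' \<in> ?K"
      have "{\<tau>\<in>?P. agr \<tau> (i, S) \<and> agr \<tau> (j, S')} = {\<tau>. \<tau> permutes U \<and> (\<forall>a\<in>S \<union> S'. \<tau> a = \<rho> i a)}"
        using True by (auto simp: agr_def)
      then show "card {\<tau>\<in>?P. agr \<tau> (i, S) \<and> agr \<tau> (j, S')} \<le> fact (?n - card (S \<union> S'))"
        using card_permutes_agreeing_le[OF U, of "S \<union> S'" "\<rho> i"] S \<open>S' \<in> ?K\<close> by simp
    qed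
    also have "\<dots> \<le> 2 ^ k * fact (?n - k)"
      using U S by (intro sum_fact_Un_le) auto
    finally show ?thesis using True by (simp add: mult_ac)
  next
    case False
    have "(\<Sum>S'\<in>?K. card {\<tau>\<in>?P. agr \<tau> (i, S) \<and> agr \<tau> (j, S')})
        = (\<Sum>S'\<in>{S'. S' \<subseteq> U - S \<and> card S' = k}. card {\<tau>\<in>?P. agr \<tau> (i, S) \<and> agr \<tau> (j, S')})"
    proof (rule sum.mono_neutral_right[OF finK])
      show "\<forall>S'\<in>?K - {S'. S' \<subseteq> U - S \<and> card S' = k}.
          card {\<tau>\<in>?P. agr \<tau> (i, S) \<and> agr \<tau> (j, S')} = 0"
      proof
        fix S' assume "S' \<in> ?K - {S'. S' \<subseteq> U - S \<and> card S' = k}"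
        then obtain x where "x \<in> S" "x \<in> S'" "x \<in> U" by auto
        \<comment> \<open>At a common point \<open>x\<close>, \<open>\<tau>\<close> would have to
          take both values \<open>\<rho> i x\<close> and \<open>\<rho> j x\<close>, which
          differ.\<close>
        then have "{\<tau>\<in>?P. agr \<tau> (i, S) \<and> agr \<tau> (j, S')} = {}"
          using dis[OF i j False] by (force simp: agr_def)
        then show "card {\<tau>\<in>?P. agr \<tau> (i, S) \<and> agr \<tau> (j, S')} = 0" by (simp only: card.empty)
      qed
    qed auto
    also have "\<dots> \<le> (\<Sum>S'\<in>{S'. S' \<subseteq> U - S \<and> card S' = k}. fact (?n - card (S \<union> S')))"
    proof (rule sum_mono)
      fix S' assume S': "S' \<in> {S'. S' \<subseteq> U - S \<and> card S' = k}"
      \<comment> \<open>By disjointness the two requirements merge into one prescription on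
        \<open>S \<union> S'\<close>.\<close>
      have "{\<tau>\<in>?P. agr \<tau> (i, S) \<and> agr \<tau> (j, S')}
          = {\<tau>. \<tau> permutes U \<and> (\<forall>a\<in>S \<union> S'. \<tau> a = (if a \<in> S then \<rho> i a else \<rho> j a))}"
        using S' by (auto simp: agr_def)
      moreover have "S \<union> S' \<subseteq> U" using S S' by auto
      ultimately show "card {\<tau>\<in>?P. agr \<tau> (i, S) \<and> agr \<tau> (j, S')} \<le> fact (?n - card (S \<union> S'))"
        using card_permutes_agreeing_le[OF U] by simp
    qed
    finally have "(\<Sum>S'\<in>?K. card {\<tau>\<in>?P. agr \<tau> (i, S) \<and> agr \<tau> (j, S')}) * fact k
      \<le> (\<Sum>S'\<in>{S'. S' \<subseteq> U - S \<and> card S' = k}. fact (?n - card (S \<union> S'))) * fact k"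
      by simp
    also have "\<dots> \<le> fact (?n - k)"
      using U S by (intro sum_fact_disjoint_le) auto
    finally show ?thesis using False by simp
  qed
  \<comment> \<open>The square of \<open>Z\<close> counts ordered pairs of agreements. The term
    \<open>?m\<^sup>2\<close> comes from the bound 1 for each pair of shifts, the other term from
    the diagonal.\<close>
  have second: "(\<Sum>\<tau>\<in>?P. (Z \<tau>)\<^sup>2) * (fact k)\<^sup>2 \<le> fact ?n * (?m * (2 ^ k * fact k) + ?m\<^sup>2)"
  proof -
    have "(\<Sum>\<tau>\<in>?P. (Z \<tau>)\<^sup>2)
        = (\<Sum>\<tau>\<in>?P. \<Sum>p\<in>?J. \<Sum>q\<in>?J. of_bool (agr \<tau> p \<and> agr \<tau> q))"
      unfolding Zsum power2_eq_square sum_product of_bool_conj ..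
    also have "\<dots> = (\<Sum>p\<in>?J. \<Sum>q\<in>?J. card {\<tau>\<in>?P. agr \<tau> p \<and> agr \<tau> q})"
      unfolding card_sum
      by (subst sum.swap, intro sum.cong[OF refl], rule sum.swap)
    also have "\<dots> = (\<Sum>i\<in>I. \<Sum>S\<in>?K. \<Sum>j\<in>I. \<Sum>S'\<in>?K.
          card {\<tau>\<in>?P. agr \<tau> (i, S) \<and> agr \<tau> (j, S')})"
      unfolding sum.cartesian_product' by simp
    finally have "(\<Sum>\<tau>\<in>?P. (Z \<tau>)\<^sup>2) * fact k = (\<Sum>i\<in>I. \<Sum>S\<in>?K. \<Sum>j\<in>I. (\<Sum>S'\<in>?K.
          card {\<tau>\<in>?P. agr \<tau> (i, S) \<and> agr \<tau> (j, S')}) * fact k)"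
      by (simp only: sum_distrib_right)
    also have "\<dots> \<le> (\<Sum>i\<in>I. \<Sum>S\<in>?K. \<Sum>j\<in>I.
          fact (?n - k) * (if i = j then 2 ^ k * fact k else 1))"
      by (intro sum_mono pair)
    also have "\<dots> \<le> (\<Sum>i\<in>I. \<Sum>S\<in>?K. fact (?n - k) * (2 ^ k * fact k + ?m))"
    proof (intro sum_mono)
      fix i assume "i \<in> I"
      have "(\<Sum>j\<in>I. if i = j then 2 ^ k * fact k else 1) \<le>
          (\<Sum>j\<in>I. (if i = j then 2 ^ k * fact k else 0) + (1 :: nat))"
        by (intro sum_mono) auto
      also have "\<dots> = 2 ^ k * fact k + ?m"
        using \<open>i \<in> I\<close> I by (subst sum.distrib) simp
      finally show "(\<Sum>j\<in>I. fact (?n - k) * (if i = j then 2 ^ k * fact k else 1))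
          \<le> fact (?n - k) * (2 ^ k * fact k + ?m)"
        by (simp add: sum_distrib_left[symmetric])
    qed
    also have "\<dots> = ?m * ((?n choose k) * fact (?n - k)) * (2 ^ k * fact k + ?m)"
      using cK by simp
    finally have "(\<Sum>\<tau>\<in>?P. (Z \<tau>)\<^sup>2) * fact k * fact k
        \<le> ?m * ((?n choose k) * fact (?n - k)) * (2 ^ k * fact k + ?m) * fact k"
      by (rule mult_right_mono) simp
    also have "\<dots> = ?m * (fact k * fact (?n - k) * (?n choose k)) * (2 ^ k * fact k + ?m)"
      by (simp add: mult_ac)
    also have "\<dots> = fact ?n * (?m * (2 ^ k * fact k) + ?m\<^sup>2)"
      unfolding binomial_fact_lemma[OF k] by (simp add: algebra_simps power2_eq_square)
    finally show ?thesis by (simp add: power2_eq_square mult_ac)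
  qed
  let ?G = "{\<tau>. \<tau> permutes U \<and> (\<exists>i\<in>I. k \<le> card {x\<in>U. \<tau> x = \<rho> i x})}"
  have supp: "{\<tau>\<in>?P. real (Z \<tau>) \<noteq> 0} \<subseteq> ?G"
  proof
    fix \<tau> assume "\<tau> \<in> {\<tau>\<in>?P. real (Z \<tau>) \<noteq> 0}"
    then have \<tau>: "\<tau> permutes U" and "{p\<in>?J. agr \<tau> p} \<noteq> {}"
      using finJ by (auto simp: Z_def simp del: Collect_empty_eq)
    then obtain i S where iS: "i \<in> I" "S \<subseteq> U" "card S = k" "\<forall>x\<in>S. \<tau> x = \<rho> i x"
      by (auto simp: agr_def)
    have "card S \<le> card {x\<in>U. \<tau> x = \<rho> i x}"
      using iS U by (intro card_mono) auto
    then show "\<tau> \<in> ?G" using \<tau> iS by auto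
  qed
  have "finite ?G" using finP by (rule rev_finite_subset) auto
  then have cardG: "card {\<tau>\<in>?P. real (Z \<tau>) \<noteq> 0} \<le> card ?G"
    using supp by (rule card_mono)
  have m: "real ?m > 0" using I by (simp add: card_gt_0_iff)
  let ?f = "real (fact ?n)"
  have "(?m * ?f)\<^sup>2 = ((\<Sum>\<tau>\<in>?P. real (Z \<tau>)) * fact k)\<^sup>2"
    using arg_cong[OF first, of real] by simp
  also have "\<dots> = (\<Sum>\<tau>\<in>?P. real (Z \<tau>))\<^sup>2 * (fact k)\<^sup>2" by (rule power_mult_distrib)
  also have "\<dots> \<le> card {\<tau>\<in>?P. real (Z \<tau>) \<noteq> 0} * (\<Sum>\<tau>\<in>?P. (real (Z \<tau>))\<^sup>2) * (fact k)\<^sup>2"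
    by (intro mult_right_mono Cauchy_Schwarz_support finP) simp
  also have "\<dots> = card {\<tau>\<in>?P. real (Z \<tau>) \<noteq> 0} * real ((\<Sum>\<tau>\<in>?P. (Z \<tau>)\<^sup>2) * (fact k)\<^sup>2)"
    by simp
  also have "\<dots> \<le> card ?G * real (fact ?n * (?m * (2 ^ k * fact k) + ?m\<^sup>2))"
    using cardG second by (intro mult_mono) (simp_all only: of_nat_le_iff of_nat_0_le_iff)
  also have "\<dots> = ?m\<^sup>2 * ?f * (card ?G * (1 + 2 ^ k * fact k / ?m))"
    using m by (simp add: field_simps power2_eq_square)
  finally have "?m\<^sup>2 * ?f * ?f \<le> ?m\<^sup>2 * ?f * (card ?G * (1 + 2 ^ k * fact k / ?m))"
    by (simp add: power2_eq_square mult_ac)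
  then show ?thesis
    using m by (subst (asm) mult_le_cancel_left_pos) simp_all
qed

section \<open>Shifts as rotations\<close>

text \<open>Points outside the range are fixed, as \<open>permutes\<close> demands.\<close>

definition rot :: "nat \<Rightarrow> nat \<Rightarrow> nat \<Rightarrow> nat" where
  "rot n h x = (if x < n then (x + h) mod n else x)"

lemma add_mod_right_cancel:
  fixes a b c n :: nat
  assumes "(a + c) mod n = (b + c) mod n" "a < n" "b < n"
  shows "a = b"
proof -
  obtain q r where "a + c + n * q = b + c + n * r"
    using assms(1) unfolding nat_mod_eq_iff by blast
  then have "a + n * q = b + n * r" by simp
  then have "(a + n * q) mod n = (b + n * r) mod n" by simp
  then show ?thesis using assms by simp
qed

lemma rot_permutes: "rot n h permutes {0..<n}"
proof (rule bij_imp_permutes)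
  have inj: "inj_on (rot n h) {0..<n}"
    by (rule inj_onI) (auto simp: rot_def dest: add_mod_right_cancel)
  moreover have "rot n h ` {0..<n} \<subseteq> {0..<n}"
    by (auto simp: rot_def)
  ultimately show "bij_betw (rot n h) {0..<n} {0..<n}"
    by (simp add: bij_betw_def endo_inj_surj)
qed (simp add: rot_def)

lemma rot_neq: "h < n \<Longrightarrow> h' < n \<Longrightarrow> h \<noteq> h' \<Longrightarrow> x < n \<Longrightarrow> rot n h x \<noteq> rot n h' x"
  using add_mod_right_cancel[of h x n h'] by (auto simp: rot_def add.commute)

text \<open>Passing to the inverse turns matches of \<open>\<sigma>\<close> into agreements with a
  fixed permutation, the form required by the second moment bound.\<close>

lemma shift_matches_eq:
  assumes "\<sigma> permutes {0..<n}"
  shows "shift_matches n \<sigma> h = {l \<in> {0..<n}. inv \<sigma> l = rot n h l}"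
  using permutes_inv_eq[OF assms] by (auto simp: shift_matches_def rot_def)

text \<open>Inversion is a bijection on the permutations, so the count of agreements with the
  \<open>n\<close> rotations transfers.\<close>

lemma card_permutes_shift_matches:
  assumes "n > 0" "k \<le> n"
  shows "fact n \<le>
    card {\<sigma>. \<sigma> permutes {0..<n} \<and> (\<exists>h<n. k \<le> card (shift_matches n \<sigma> h))}
      * (1 + 2 ^ k * fact k / real n)"
proof -
  let ?A = "{\<sigma>. \<sigma> permutes {0..<n} \<and> (\<exists>h<n. k \<le> card (shift_matches n \<sigma> h))}"
  let ?B = "{\<tau>. \<tau> permutes {0..<n} \<and> (\<exists>h\<in>{0..<n}. k \<le> card {l\<in>{0..<n}. \<tau> l = rot n h l})}"
  have "bij_betw inv ?A ?B"
    by (rule bij_betw_byWitness[where f' = inv])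
      (auto simp: shift_matches_eq permutes_inv permutes_inv_inv)
  then have "card ?A = card ?B" by (rule bij_betw_same_card)
  moreover have "fact (card {0..<n}) \<le> card ?B * (1 + 2 ^ k * fact k / real (card {0..<n}))"
    using assms rot_neq by (intro card_permutes_many_agreements_ge rot_permutes) auto
  ultimately show ?thesis by simp
qed

section \<open>Symmetry under conjugation by rotations\<close>

text \<open>Rotating by \<open>s\<close> commutes with adding \<open>h\<close> modulo
  \<open>n\<close>, so conjugation carries a match at \<open>l\<close> to a match at
  \<open>rot n s l\<close> for the same shift \<open>h\<close>.\<close>

lemma rot_conj_apply:
  assumes "\<sigma> permutes {0..<n}" "l < n"
  shows "(rot n s \<circ> \<sigma> \<circ> inv (rot n s)) ((rot n s l + h) mod n) = rot n s l
           \<longleftrightarrow> \<sigma> ((l + h) mod n) = l"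
proof -
  have "(rot n s l + h) mod n = rot n s ((l + h) mod n)"
    using assms(2) by (simp add: rot_def mod_simps ac_simps)
  then show ?thesis
    using permutes_inverses(2)[OF rot_permutes] permutes_inj[OF rot_permutes]
    by (simp add: inj_eq)
qed

lemma shift_matches_rot_conj:
  assumes "\<sigma> permutes {0..<n}"
  shows "shift_matches n (rot n s \<circ> \<sigma> \<circ> inv (rot n s)) h = rot n s ` shift_matches n \<sigma> h"
    (is "shift_matches n ?c h = _")
proof -
  have "shift_matches n ?c h = {l \<in> rot n s ` {0..<n}. ?c ((l + h) mod n) = l}"
    unfolding permutes_image[OF rot_permutes] by (auto simp: shift_matches_def)
  also have "\<dots> = rot n s ` {l \<in> {0..<n}. ?c ((rot n s l + h) mod n) = rot n s l}"
    by blast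
  also have "\<dots> = rot n s ` shift_matches n \<sigma> h"
    using rot_conj_apply[OF assms] by (intro arg_cong[where f = "image _"]) (auto simp: shift_matches_def)
  finally show ?thesis .
qed

text \<open>Match sets are only translated, so their sizes are kept. As the tie-breaking rule sees
  nothing but this set, the hint has the same distribution after conjugation.\<close>

lemma best_shifts_rot_conj:
  assumes "\<sigma> permutes {0..<n}"
  shows "best_shifts n (rot n s \<circ> \<sigma> \<circ> inv (rot n s)) = best_shifts n \<sigma>"
proof -
  have "inj_on (rot n s) A" for A
    using permutes_inj[OF rot_permutes] inj_on_subset by blast
  then show ?thesis
    by (simp add: best_shifts_def shift_matches_rot_conj[OF assms] card_image)
qed

lemma sum_permutes_conj:
  assumes "p permutes S"
  shows "(\<Sum>\<sigma> | \<sigma> permutes S. f (p \<circ> \<sigma> \<circ> inv p)) = (\<Sum>\<sigma> | \<sigma> permutes S. f \<sigma>)"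
proof -
  have "(\<Sum>\<sigma> | \<sigma> permutes S. f \<sigma>) = (\<Sum>\<sigma> | \<sigma> permutes S. f (\<sigma> \<circ> inv p))"
    using assms by (intro sum_permutations_compose_right permutes_inv)
  also have "\<dots> = (\<Sum>\<sigma> | \<sigma> permutes S. f (p \<circ> \<sigma> \<circ> inv p))"
    using assms by (rule setum_permutations_compose_left)
  finally show ?thesis ..
qed

section \<open>The success probability of the shift strategy\<close>

lemma finite_best_shifts: "finite (best_shifts n \<sigma>)"
  by (rule finite_subset[of _ "{0..<n}"]) (auto simp: best_shifts_def is_arg_max_def)

lemma best_shifts_nonempty:
  assumes "n > 0"
  shows "best_shifts n \<sigma> \<noteq> {}"
proof -
  let ?f = "\<lambda>h. card (shift_matches n \<sigma> h)"
  have "Max (?f ` {0..<n}) \<in> ?f ` {0..<n}" using assms by (intro Max_in) auto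
  then obtain h where "h \<in> {0..<n}" "?f h = Max (?f ` {0..<n})" by auto
  then have "h \<in> best_shifts n \<sigma>"
    by (auto simp: best_shifts_def is_arg_max_linorder)
  then show ?thesis by blast
qed

lemma set_pmf_tie_breaking:
  assumes "n > 0" "tie_breaking T"
  shows "set_pmf (T (best_shifts n \<sigma>)) \<subseteq> best_shifts n \<sigma>"
  using assms best_shifts_nonempty by (auto simp: tie_breaking_def)

lemma found_prob_shift:
  assumes "n > 0" "tie_breaking T"
  shows
  "found_prob n (shift_hint n T) (shift_index n) s =
     (\<Sum>\<sigma> | \<sigma> permutes {0..<n}.
        measure_pmf.prob (T (best_shifts n \<sigma>)) {h. \<sigma> ((s + h) mod n) = s}) / fact n"
proof -
  let ?P = "{\<sigma>. \<sigma> permutes {0..<n}}"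
  let ?V = "{(\<sigma>, h, i). \<sigma> i = s} :: ((nat \<Rightarrow> nat) \<times> nat \<times> nat) set"
  let ?g = "\<lambda>\<sigma>. map_pmf (\<lambda>h. (\<sigma>, h, (s + h) mod n)) (T (best_shifts n \<sigma>))"
  have P: "finite ?P" "card ?P = fact n" "?P \<noteq> {}"
    using card_permutations[of "{0..<n}" n] permutes_id[of "{0..<n}"]
    by (auto simp: finite_permutations simp del: permutes_id)
  \<comment> \<open>Finite supports let the expectation over the bind be expanded as a finite
    sum.\<close>
  have fin: "finite (set_pmf (T (best_shifts n \<sigma>)))" for \<sigma>
    using set_pmf_tie_breaking[OF assms] finite_best_shifts by (rule finite_subset)
  have "needle_game n (shift_hint n T) (shift_index n) s = pmf_of_set ?P \<bind> ?g"
    by (simp add: needle_game_def shift_hint_def shift_index_def bind_return_pmf map_pmf_def)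
  then have "found_prob n (shift_hint n T) (shift_index n) s
      = measure_pmf.expectation (pmf_of_set ?P \<bind> ?g) (indicator ?V)"
    by (simp add: found_prob_def)
  also have "\<dots> = (\<Sum>\<sigma>\<in>?P. measure_pmf.expectation (?g \<sigma>) (indicator ?V) / card ?P)"
    using P fin by (subst pmf_expectation_bind_pmf_of_set) (simp_all add: divide_inverse mult.commute)
  also have "\<dots> = (\<Sum>\<sigma>\<in>?P. measure_pmf.prob (T (best_shifts n \<sigma>)) {h. \<sigma> ((s + h) mod n) = s} / fact n)"
    using P by (simp add: vimage_def)
  finally show ?thesis by (simp add: sum_divide_distrib)
qed

text \<open>Conjugation by \<open>rot n s\<close> permutes the permutations and turns finding 0 into
  finding \<open>s\<close>, with equal hint distribution.\<close>

lemma found_prob_shift_indep: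
  assumes "s < n" "tie_breaking T"
  shows "found_prob n (shift_hint n T) (shift_index n) s
       = found_prob n (shift_hint n T) (shift_index n) 0"
proof -
  define g where "g s \<sigma> = measure_pmf.prob (T (best_shifts n \<sigma>)) {h. \<sigma> ((s + h) mod n) = s}"
    for s and \<sigma> :: "nat \<Rightarrow> nat"
  have "g s (rot n s \<circ> \<sigma> \<circ> inv (rot n s)) = g 0 \<sigma>" if "\<sigma> permutes {0..<n}" for \<sigma>
    \<comment> \<open>The case \<open>l = 0\<close>: since \<open>s < n\<close>,
      \<open>rot n s 0\<close> is \<open>s\<close>.\<close>
    using rot_conj_apply[OF that, of 0 s] best_shifts_rot_conj[OF that] assms
    by (simp add: g_def rot_def[of n s 0])
  then have "(\<Sum>\<sigma> | \<sigma> permutes {0..<n}. g 0 \<sigma>) = (\<Sum>\<sigma> | \<sigma> permutes {0..<n}. g s \<sigma>)"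
    by (subst sum_permutes_conj[OF rot_permutes[of n s], symmetric]) simp
  then show ?thesis using assms by (simp add: found_prob_shift g_def)
qed

text \<open>By linearity the sum is the expected size of the match set of the hint. Every hint in
  the support is a maximizer, so its match set is at least as large as that of
  \<open>h\<close>.\<close>

lemma sum_prob_shift_ge:
  assumes "n > 0" "tie_breaking T" "h < n" "k \<le> card (shift_matches n \<sigma> h)"
  shows "real k \<le> (\<Sum>s<n. measure_pmf.prob (T (best_shifts n \<sigma>)) {h. \<sigma> ((s + h) mod n) = s})"
proof -
  let ?M = "T (best_shifts n \<sigma>)"
  have supp: "set_pmf ?M \<subseteq> best_shifts n \<sigma>"
    using assms(1,2) by (rule set_pmf_tie_breaking)
  have ge: "k \<le> card (shift_matches n \<sigma> h')" if "h' \<in> set_pmf ?M" for h'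
  proof -
    have "card (shift_matches n \<sigma> h) \<le> card (shift_matches n \<sigma> h')"
      using that supp assms(3) by (auto simp: best_shifts_def is_arg_max_linorder)
    then show ?thesis using assms(4) by simp
  qed
  have card_eq: "(\<Sum>s<n. indicator {h. \<sigma> ((s + h) mod n) = s} h') = real (card (shift_matches n \<sigma> h'))" for h'
  proof -
    have "shift_matches n \<sigma> h' = {s\<in>{..<n}. \<sigma> ((s + h') mod n) = s}"
      by (auto simp: shift_matches_def)
    then show ?thesis by (simp add: indicator_def sum.If_cases Int_def)
  qed
  have "finite (set_pmf ?M)" using supp finite_best_shifts by (rule finite_subset)
  then have int: "integrable (measure_pmf ?M) f" for f :: "nat \<Rightarrow> real"
    by (rule integrable_measure_pmf_finite)
  have "real k = measure_pmf.expectation ?M (\<lambda>_. real k)" by simp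
  also have "\<dots> \<le> measure_pmf.expectation ?M (\<lambda>h'. real (card (shift_matches n \<sigma> h')))"
    using ge by (intro integral_mono_AE int) (auto simp: AE_measure_pmf_iff)
  also have "\<dots> = (\<Sum>s<n. measure_pmf.expectation ?M (indicator {h. \<sigma> ((s + h) mod n) = s}))"
    unfolding card_eq[symmetric] by (intro Bochner_Integration.integral_sum int)
  finally show ?thesis by simp
qed

text \<open>Permutations with a shift of at least \<open>k\<close> matches each contribute at least
  \<open>k\<close> to the sum over all sought numbers; by symmetry each sought number receives an
  equal share of the total.\<close>

lemma found_prob_shift_ge:
  assumes "s < n" "tie_breaking T" "k \<le> n"
  shows "found_prob n (shift_hint n T) (shift_index n) s
           \<ge> real k / (real n * (1 + 2 ^ k * fact k / real n))"
proof -
  let ?F = "found_prob n (shift_hint n T) (shift_index n)"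
  let ?P = "{\<sigma>. \<sigma> permutes {0..<n}}"
  let ?G = "{\<sigma>. \<sigma> permutes {0..<n} \<and> (\<exists>h<n. k \<le> card (shift_matches n \<sigma> h))}"
  let ?p = "\<lambda>\<sigma> s. measure_pmf.prob (T (best_shifts n \<sigma>)) {h. \<sigma> ((s + h) mod n) = s}"
  let ?D = "1 + 2 ^ k * fact k / real n"
  have n: "n > 0" using assms by simp
  have D: "?D > 0" by (simp add: add_pos_nonneg)
  have "fact n * real k \<le> card ?G * ?D * real k"
    using card_permutes_shift_matches[OF n assms(3)] by (intro mult_right_mono) simp_all
  also have "card ?G * ?D * real k = (\<Sum>\<sigma>\<in>?G. real k) * ?D" by simp
  also have "(\<Sum>\<sigma>\<in>?G. real k) \<le> (\<Sum>\<sigma>\<in>?G. \<Sum>s<n. ?p \<sigma> s)"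
    using sum_prob_shift_ge[OF n assms(2)] by (intro sum_mono) auto
  also have "\<dots> \<le> (\<Sum>\<sigma>\<in>?P. \<Sum>s<n. ?p \<sigma> s)"
    by (intro sum_mono2) (auto simp: finite_permutations intro: sum_nonneg)
  also have "\<dots> = (\<Sum>s<n. \<Sum>\<sigma>\<in>?P. ?p \<sigma> s)" by (rule sum.swap)
  also have "\<dots> = (\<Sum>s<n. fact n * ?F s)"
    using n assms(2) by (simp add: found_prob_shift)
  also have "\<dots> = (\<Sum>s'<n. fact n * ?F s)"
    using found_prob_shift_indep assms(1,2) by (intro sum.cong) (metis lessThan_iff)+
  also have "\<dots> = fact n * (n * ?F s)" by simp
  finally have "fact n * real k \<le> fact n * (n * ?F s * ?D)"
    using D by (simp add: mult_ac)
  then have "real k \<le> n * ?F s * ?D" by simp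
  then show ?thesis using n D by (simp add: divide_le_eq mult_ac)
qed

section \<open>Asymptotics\<close>

text \<open>
  To be used for \<open>L = ln n\<close>: with \<open>k = \<lfloor>(1 - 1 / ln (ln n)) * ln n / ln (ln n)\<rfloor>\<close> one has
  \<open>2\<^sup>k * k! \<le> (2 * k)\<^sup>k \<le> (ln n)\<^sup>k \<le> n * exp (- ln n / ln (ln n))\<close>.
\<close>

lemma two_power_mult_fact_le:
  fixes L :: real
  assumes "ln L \<ge> 2" "L > 0" "real k \<le> (1 - 1 / ln L) * L / ln L"
  shows "2 ^ k * fact k \<le> exp L * exp (- L / ln L)"
proof -
  have "L > 1" using assms ln_gt_zero_iff[of L] by linarith
  \<comment> \<open>This yields \<open>2 * real k \<le> L\<close>, so that the base of
    \<open>(2 * real k) ^ k\<close> may be replaced by \<open>L\<close>.\<close>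
  then have "(1 - 1 / ln L) * L / ln L \<le> 1 * L / 2"
    using assms by (intro frac_le mult_right_mono) simp_all
  with assms(3) have k: "2 * real k \<le> L" by linarith
  have "2 ^ k * fact k \<le> 2 ^ k * real k ^ k"
    using fact_le_power[of k, where ?'a = real] by (intro mult_left_mono) auto
  also have "\<dots> = (2 * real k) ^ k" by (simp add: power_mult_distrib)
  also have "\<dots> \<le> L ^ k" using k by (intro power_mono) auto
  also have "\<dots> = exp (real k * ln L)"
    using assms by (simp add: exp_of_nat_mult)
  also have "\<dots> \<le> exp (L - L / ln L)"
  proof -
    have "ln L > 0" using assms(1) by linarith
    \<comment> \<open>The factor \<open>1 - 1 / ln L\<close> provides the slack
      \<open>L / ln L\<close> in the exponent, which makes the error term vanish in the
      limit.\<close>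
    from assms(3) have "real k * ln L \<le> (1 - 1 / ln L) * L"
      unfolding pos_le_divide_eq[OF \<open>ln L > 0\<close>] .
    then show ?thesis by (simp add: left_diff_distrib)
  qed
  finally show ?thesis by (simp add: exp_add[symmetric])
qed

theorem theorem6:
  "\<exists>\<epsilon> :: nat \<Rightarrow> real. \<epsilon> \<longlonglongrightarrow> 0 \<and>
     (\<forall>n \<ge> 3. \<forall>s < n. \<forall>T. tie_breaking T \<longrightarrow>
        found_prob n (shift_hint n T) (shift_index n) s
          \<ge> (1 + \<epsilon> n) * log 2 (real n) / (real n * log 2 (log 2 (real n))))"
proof -
  define x where "x n = (1 - 1 / ln (ln (real n))) * ln (real n) / ln (ln (real n))" for n :: nat
  \<comment> \<open>\<open>c n / n\<close> is the bound of \<open>found_prob_shift_ge\<close> with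
    \<open>k\<close> replaced by its lower bound \<open>x n - 1\<close> and the error term by its
    upper bound. Then \<open>\<epsilon>\<^sub>0\<close> is solved from equating this with the
    claimed bound.\<close>
  define c where "c n = (x n - 1) / (1 + exp (- ln (real n) / ln (ln (real n))))" for n
  define \<epsilon>\<^sub>0 where "\<epsilon>\<^sub>0 n = c n * log 2 (log 2 (real n)) / log 2 (real n) - 1" for n
  have lim: "\<epsilon>\<^sub>0 \<longlonglongrightarrow> 0"
    unfolding \<epsilon>\<^sub>0_def c_def x_def log_def by real_asymp
  have "eventually (\<lambda>n. ln (ln (real n)) \<ge> 2 \<and> x n \<le> real n \<and> x n \<ge> 1) sequentially"
    unfolding x_def by (intro eventually_conj; real_asymp)
  then obtain N where N: "\<And>n. n \<ge> N \<Longrightarrow> ln (ln (real n)) \<ge> 2 \<and> x n \<le> real n \<and> x n \<ge> 1"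
    by (auto simp: eventually_sequentially)
  \<comment> \<open>For small \<open>n\<close> the value -1 makes the claimed bound 0.\<close>
  define \<epsilon> where "\<epsilon> n = (if n \<ge> N then \<epsilon>\<^sub>0 n else -1)" for n
  have "\<epsilon> \<longlonglongrightarrow> 0"
    using lim by (rule Lim_transform_eventually) 
      (auto simp: \<epsilon>_def eventually_sequentially intro!: exI[of _ N])
  moreover have "found_prob n (shift_hint n T) (shift_index n) s
          \<ge> (1 + \<epsilon> n) * log 2 (real n) / (real n * log 2 (log 2 (real n)))"
    if n: "n \<ge> 3" and s: "s < n" and T: "tie_breaking T" for n s T
  proof (cases "n \<ge> N")
    case False
    then show ?thesis by (simp add: \<epsilon>_def found_prob_def)
  next
    case True
    define k where "k = nat \<lfloor>x n\<rfloor>"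
    have k: "real k \<le> x n" "x n - 1 \<le> real k" using N[OF True] unfolding k_def by linarith+
    \<comment> \<open>From \<open>n \<ge> 3\<close> the iterated logarithm is positive, so the
      logarithms cancel without division by 0.\<close>
    have L: "log 2 (real n) > 1" using n by (subst less_log_iff) auto
    then have LL: "log 2 (log 2 (real n)) > 0" by simp
    have "2 ^ k * fact k \<le> exp (ln (real n)) * exp (- ln (real n) / ln (ln (real n)))"
      using N[OF True] k(1) n by (intro two_power_mult_fact_le) (auto simp: x_def)
    then have D: "2 ^ k * fact k / real n \<le> exp (- ln (real n) / ln (ln (real n)))"
      using n by (simp add: field_simps)
    have "(1 + \<epsilon> n) * log 2 (real n) / (real n * log 2 (log 2 (real n))) = c n / n"
      using True L LL[THEN less_imp_neq] by (simp add: \<epsilon>_def \<epsilon>\<^sub>0_def)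
    also have "\<dots> = (x n - 1) / (real n * (1 + exp (- ln (real n) / ln (ln (real n)))))"
      by (simp add: c_def mult.commute)
    also have "\<dots> \<le> real k / (real n * (1 + 2 ^ k * fact k / real n))"
      using k D n N[OF True] by (intro frac_le mult_left_mono add_left_mono mult_pos_pos add_pos_nonneg) auto
    also have "\<dots> \<le> found_prob n (shift_hint n T) (shift_index n) s"
      using k N[OF True] by (intro found_prob_shift_ge s T) linarith
    finally show ?thesis .
  qed
  ultimately show ?thesis by blast
qed

end
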